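(* Let $0<\lambda\le\Lambda$. There exist constants $\eta>2$ and $\gamma>0$, depending only on $\lambda,\Lambda$, such that the following holds for every operator $L=a_{11}X_1^2+2a_{12}X_2X_1+a_{22}X_2^2$ with ellipticity constants $\lambda,\Lambda$, every $y\in\mathbb{R}^2$ and every $r>0$ (that is, $L$ satisfies the Double Ball Property in $B(y,\eta r)$): if $u\in C^2(B(y,\eta r))\cap C(\overline{B(y,\eta r)})$ satisfies $u\ge 0$ and $Lu\le 0$ in $B(y,\eta r)$ and $u\ge 1$ on $B(y,r)$, then $u\ge\gamma$ in $B(y,2r)$.
   Context: On $\mathbb{R}^2$ with points $x=(x_1,x_2)$, let $X_1=\partial_{x_1}$ and $X_2=x_1\partial_{x_2}$ (Grushin vector fields). The operator is $L=a_{11}X_1^2+2a_{12}X_2X_1+a_{22}X_2^2$, i.e. $Lu=a_{11}u_{x_1x_1}+2a_{12}X_2X_1u+a_{22}X_2^2u$ with $X_2X_1u=x_1u_{x_1x_2}$ and $X_2^2u=x_1^2u_{x_2x_2}$, where $a_{11},a_{12},a_{22}$ are measurable real functions on $\mathbb{R}^2$ such that at every point $\lambda(\xi_1^2+\xi_2^2)\le a_{11}\xi_1^2+2a_{12}\xi_1\xi_2+a_{22}\xi_2^2\le\Lambda(\xi_1^2+\xi_2^2)$ for all $\xi\in\mathbb{R}^2$; then $\lambda,\Lambda$ are called ellipticity constants of $L$. For $x,y\in\mathbb{R}^2$ put $\tilde d(x,y)=|x_1-y_1|+\sqrt{x_1^2+y_1^2+4|x_2-y_2|}-\sqrt{x_1^2+y_1^2}$,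 and let $B(y,r)=\{x\in\mathbb{R}^2:\tilde d(x,y)<r\}$. *)

theory Defs
  imports "HOL-Analysis.Analysis"
begin

definition pd1 :: "(real \<times> real \<Rightarrow> real) \<Rightarrow> real \<times> real \<Rightarrow> real" where
  "pd1 u x = deriv (\<lambda>t. u (t, snd x)) (fst x)"

definition pd2 :: "(real \<times> real \<Rightarrow> real) \<Rightarrow> real \<times> real \<Rightarrow> real" where
  "pd2 u x = deriv (\<lambda>t. u (fst x, t)) (snd x)"

text \<open>
  The differentiability conjuncts are needed because \<^const>\<open>deriv\<close> is an arbitrary value
  where no derivative exists. For open \<open>S\<close>, continuity of \<open>u\<close> itself follows.
\<close>

definition C1_on :: "(real \<times> real) set \<Rightarrow> (real \<times> real \<Rightarrow> real) \<Rightarrow> bool" where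
  "C1_on S u \<longleftrightarrow>
     (\<forall>x\<in>S. (\<lambda>t. u (t, snd x)) differentiable (at (fst x)) \<and>
            (\<lambda>t. u (fst x, t)) differentiable (at (snd x))) \<and>
     continuous_on S (pd1 u) \<and> continuous_on S (pd2 u)"

definition C2_on :: "(real \<times> real) set \<Rightarrow> (real \<times> real \<Rightarrow> real) \<Rightarrow> bool" where
  "C2_on S u \<longleftrightarrow> C1_on S u \<and> C1_on S (pd1 u) \<and> C1_on S (pd2 u)"

definition X1 :: "(real \<times> real \<Rightarrow> real) \<Rightarrow> real \<times> real \<Rightarrow> real" where
  "X1 u = pd1 u"

definition X2 :: "(real \<times> real \<Rightarrow> real) \<Rightarrow> real \<times> real \<Rightarrow> real" where
  "X2 u = (\<lambda>x. fst x * pd2 u x)"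

definition grushin_op ::
  "(real \<times> real \<Rightarrow> real) \<Rightarrow> (real \<times> real \<Rightarrow> real) \<Rightarrow> (real \<times> real \<Rightarrow> real) \<Rightarrow>
   (real \<times> real \<Rightarrow> real) \<Rightarrow> real \<times> real \<Rightarrow> real" where
  "grushin_op a11 a12 a22 u x =
     a11 x * X1 (X1 u) x + 2 * a12 x * X2 (X1 u) x + a22 x * X2 (X2 u) x"

definition ellipticity_constants ::
  "real \<Rightarrow> real \<Rightarrow> (real \<times> real \<Rightarrow> real) \<Rightarrow> (real \<times> real \<Rightarrow> real) \<Rightarrow> (real \<times> real \<Rightarrow> real) \<Rightarrow> bool" where
  "ellipticity_constants l L a11 a12 a22 \<longleftrightarrow>
     (\<forall>x \<xi>1 \<xi>2.
        l * (\<xi>1\<^sup>2 + \<xi>2\<^sup>2) \<le> a11 x * \<xi>1\<^sup>2 + 2 * a12 x * \<xi>1 * \<xi>2 + a22 x * \<xi>2\<^sup>2 \<and>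
        a11 x * \<xi>1\<^sup>2 + 2 * a12 x * \<xi>1 * \<xi>2 + a22 x * \<xi>2\<^sup>2 \<le> L * (\<xi>1\<^sup>2 + \<xi>2\<^sup>2))"

definition grushin_dist :: "real \<times> real \<Rightarrow> real \<times> real \<Rightarrow> real" where
  "grushin_dist x y =
     \<bar>fst x - fst y\<bar> + sqrt ((fst x)\<^sup>2 + (fst y)\<^sup>2 + 4 * \<bar>snd x - snd y\<bar>)
       - sqrt ((fst x)\<^sup>2 + (fst y)\<^sup>2)"

definition grushin_ball :: "real \<times> real \<Rightarrow> real \<Rightarrow> (real \<times> real) set" where
  "grushin_ball y r = {x. grushin_dist x y < r}"

definition double_ball_property ::
  "((real \<times> real \<Rightarrow> real) \<Rightarrow> real \<times> real \<Rightarrow> real) \<Rightarrow> real \<Rightarrow> real \<Rightarrow> real \<times> real \<Rightarrow> real \<Rightarrow> bool" where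
  "double_ball_property L \<eta> \<gamma> y r \<longleftrightarrow>
     (\<forall>u. C2_on (grushin_ball y (\<eta> * r)) u \<and>
          continuous_on (closure (grushin_ball y (\<eta> * r))) u \<and>
          (\<forall>x\<in>grushin_ball y (\<eta> * r). 0 \<le> u x \<and> L u x \<le> 0) \<and>
          (\<forall>x\<in>grushin_ball y r. 1 \<le> u x)
        \<longrightarrow> (\<forall>x\<in>grushin_ball y (2 * r). \<gamma> \<le> u x))"

end

(* For y = (a,b) put X = (x1 - c)/r and T = (x2 - b)/(r(|a| + r)), where c is a moved by r/4 away
   from the degenerate line x1 = 0. A Gaussian exp(-K(X^2 + T^2)), K a large multiple of Lam/lam,
   is a strict subsolution on X^2 + T^2 < 16 off the small box |X| <= 1/8, |T| <= 1/32: where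
   |X| > 1/8 the X1-derivative alone is large enough, whatever the degeneracy, and where
   |X| <= 1/8 the point stays at distance at least |a| + r/8 from the line x1 = 0, so that the
   X2-derivative takes over. The box lies in B(y,r), so comparison with u gives the bound. *)
theory Submission
  imports Defs
begin

section \<open>The second-order condition at a minimum\<close>

lemma taylor_second_order:
  fixes f f' f'' :: "real \<Rightarrow> real"
  assumes "0 < h"
    and "\<And>t. 0 \<le> t \<Longrightarrow> t \<le> h \<Longrightarrow> (f has_real_derivative f' t) (at t)"
    and "\<And>t. 0 \<le> t \<Longrightarrow> t \<le> h \<Longrightarrow> (f' has_real_derivative f'' t) (at t)"
  obtains t where "0 < t" "t < h" "f h = f 0 + h * f' 0 + h\<^sup>2 / 2 * f'' t"
proof -
  define D where "D = (\<lambda>m::nat. if m = 0 then f else if m = 1 then f' else f'')"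
  have "\<exists>t>0. t < h \<and> f h = (\<Sum>m<2. D m 0 / fact m * h ^ m) + D 2 t / fact 2 * h ^ 2"
    using assms by (intro Maclaurin) (auto simp: D_def less_2_cases_iff)
  then obtain t where "0 < t" "t < h"
    "f h = (\<Sum>m<2. D m 0 / fact m * h ^ m) + D 2 t / fact 2 * h ^ 2"
    by blast
  then show ?thesis
    by (intro that[of t]) (auto simp: D_def numeral_2_eq_2 algebra_simps)
qed

text \<open>The nonnegative increment from \<open>(a, b)\<close> to
  \<open>(a + h * p, b + h * q)\<close> is expanded along a vertical leg followed by a horizontal
  one. The first derivatives vanish at the minimum, so after division by
  \<open>h\<^sup>2 / 2\<close> the quadratic form remains, with coefficients taken at nearby points.
  Continuity of the second derivatives moves them to \<open>(a, b)\<close>, at the cost of an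
  arbitrarily small error \<open>e\<close>.\<close>

lemma hessian_nonneg_at_min:
  fixes w w1 w2 w11 w12 w22 :: "real \<times> real \<Rightarrow> real"
  assumes "open S" and x: "(a, b) \<in> S"
    and d1: "\<And>s t. (s, t) \<in> S \<Longrightarrow> ((\<lambda>s. w (s, t)) has_real_derivative w1 (s, t)) (at s)"
    and d2: "\<And>s t. (s, t) \<in> S \<Longrightarrow> ((\<lambda>t. w (s, t)) has_real_derivative w2 (s, t)) (at t)"
    and d11: "\<And>s t. (s, t) \<in> S \<Longrightarrow> ((\<lambda>s. w1 (s, t)) has_real_derivative w11 (s, t)) (at s)"
    and d12: "\<And>s t. (s, t) \<in> S \<Longrightarrow> ((\<lambda>t. w1 (s, t)) has_real_derivative w12 (s, t)) (at t)"
    and d22: "\<And>s t. (s, t) \<in> S \<Longrightarrow> ((\<lambda>t. w2 (s, t)) has_real_derivative w22 (s, t)) (at t)"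
    and c11: "continuous_on S w11" and c12: "continuous_on S w12" and c22: "continuous_on S w22"
    and min: "\<And>z. z \<in> S \<Longrightarrow> w (a, b) \<le> w z"
  shows "0 \<le> w11 (a, b) * p\<^sup>2 + 2 * w12 (a, b) * p * q + w22 (a, b) * q\<^sup>2"
proof -
  obtain d where "0 < d" and d: "ball (a, b) d \<subseteq> S"
    using \<open>open S\<close> x open_contains_ball by blast
  have near: "(a + s, b + t) \<in> ball (a, b) e" if "\<bar>s\<bar> + \<bar>t\<bar> < e" for s t e
    using that sqrt_sum_squares_le_sum_abs[of s t] by (simp add: dist_Pair_Pair dist_real_def)
  have w1_0: "w1 (a, b) = 0"
  proof (rule DERIV_local_min[OF d1[OF x] \<open>0 < d\<close>])
    have "(a + (s - a), b + 0) \<in> S" if "\<bar>a - s\<bar> < d" for s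
      using that by (intro subsetD[OF d] near) simp
    then show "\<forall>s. \<bar>a - s\<bar> < d \<longrightarrow> w (a, b) \<le> w (s, b)"
      using min by simp
  qed
  have w2_0: "w2 (a, b) = 0"
  proof (rule DERIV_local_min[OF d2[OF x] \<open>0 < d\<close>])
    have "(a + 0, b + (t - b)) \<in> S" if "\<bar>b - t\<bar> < d" for t
      using that by (intro subsetD[OF d] near) simp
    then show "\<forall>t. \<bar>b - t\<bar> < d \<longrightarrow> w (a, b) \<le> w (a, t)"
      using min by simp
  qed
  \<comment> \<open>If each second derivative is off by at most \<open>e / ?C\<close>, the quadratic
    form is off by at most \<open>e\<close>. The summand 1 keeps \<open>?C\<close> positive when
    \<open>p = q = 0\<close>.\<close>
  let ?C = "p\<^sup>2 + 2 * \<bar>p * q\<bar> + q\<^sup>2 + 1"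
  have "0 \<le> w11 (a, b) * p\<^sup>2 + 2 * w12 (a, b) * p * q + w22 (a, b) * q\<^sup>2 + e" if "0 < e" for e
  proof -
    define e' where "e' = e / ?C"
    have C: "0 < ?C"
      by (smt (verit) zero_le_power2)
    have "0 < e'"
      using C that by (simp add: e'_def)
    have cont: "\<exists>d>0. \<forall>z\<in>ball (a, b) d. \<bar>f z - f (a, b)\<bar> < e'" if "continuous_on S f" for f
    proof -
      have "isCont f (a, b)"
        using that \<open>open S\<close> x continuous_on_eq_continuous_at by blast
      then show ?thesis
        using \<open>0 < e'\<close> unfolding continuous_at_eps_delta
        by (metis dist_commute dist_real_def mem_ball)
    qed
    obtain e1 where "0 < e1" and e1: "\<And>z. z \<in> ball (a, b) e1 \<Longrightarrow> \<bar>w11 z - w11 (a, b)\<bar> < e'"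
      using cont[OF c11] by blast
    obtain e2 where "0 < e2" and e2: "\<And>z. z \<in> ball (a, b) e2 \<Longrightarrow> \<bar>w12 z - w12 (a, b)\<bar> < e'"
      using cont[OF c12] by blast
    obtain e3 where "0 < e3" and e3: "\<And>z. z \<in> ball (a, b) e3 \<Longrightarrow> \<bar>w22 z - w22 (a, b)\<bar> < e'"
      using cont[OF c22] by blast
    define m where "m = min d (min e1 (min e2 e3))"
    \<comment> \<open>Both legs then stay in the ball of radius \<open>m\<close>, by comparison with
      the l1 norm. The 1 in the denominator covers \<open>p = q = 0\<close>.\<close>
    define h where "h = m / (2 * (\<bar>p\<bar> + \<bar>q\<bar> + 1))"
    have "0 < m"
      using \<open>0 < d\<close> \<open>0 < e1\<close> \<open>0 < e2\<close> \<open>0 < e3\<close> by (simp add: m_def)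
    have pq: "0 < \<bar>p\<bar> + \<bar>q\<bar> + 1"
      by linarith
    have "0 < h"
      using \<open>0 < m\<close> pq by (simp add: h_def)
    have "h * (\<bar>p\<bar> + \<bar>q\<bar> + 1) = m / 2"
      unfolding h_def using pq by (simp only: divide_divide_eq_left[symmetric]) (metis
          less_irrefl nonzero_eq_divide_eq)
    then have hm: "h * (\<bar>p\<bar> + \<bar>q\<bar> + 1) < m"
      using \<open>0 < m\<close> by linarith
    have near': "(a + s * p, b + t * q) \<in> ball (a, b) m"
      if "0 \<le> s" "s \<le> h" "0 \<le> t" "t \<le> h" for s t
    proof (rule near)
      have "\<bar>s * p\<bar> \<le> h * \<bar>p\<bar>" "\<bar>t * q\<bar> \<le> h * \<bar>q\<bar>"
        using that by (auto simp: abs_mult intro: mult_right_mono)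
      then show "\<bar>s * p\<bar> + \<bar>t * q\<bar> < m"
        using hm \<open>0 < h\<close> by (simp add: algebra_simps)
    qed
    have inS: "(a + s * p, b + t * q) \<in> S"
      if "0 \<le> s" "s \<le> h" "0 \<le> t" "t \<le> h" for s t
      using near'[OF that] d by (auto simp: m_def)
    have chain: "((\<lambda>s. f (c + s * k)) has_real_derivative k * D) (at s)"
      if "(f has_real_derivative D) (at (c + s * k))" for f :: "real \<Rightarrow> real" and D c s k
    proof -
      have "((\<lambda>s. c + s * k) has_real_derivative k) (at s)"
        by (auto intro!: derivative_eq_intros)
      then show ?thesis
        using DERIV_chain2[where f = f and g = "\<lambda>s. c + s * k"] that by (metis mult.commute)
    qed
    \<comment> \<open>Moving in the first coordinate last makes \<open>w12\<close> the only mixed derivative that occurs,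
      so that no symmetry of mixed derivatives is needed.\<close>
    obtain t1 where t1: "0 < t1" "t1 < h" "w (a + h * p, b + h * q) = w (a, b + h * q)
        + h * (p * w1 (a, b + h * q)) + h\<^sup>2 / 2 * (p * (p * w11 (a + t1 * p, b + h * q)))"
    proof (rule taylor_second_order[OF \<open>0 < h\<close>,
          of "\<lambda>s. w (a + s * p, b + h * q)" "\<lambda>s. p * w1 (a + s * p, b + h * q)"
             "\<lambda>s. p * (p * w11 (a + s * p, b + h * q))"])
      fix s assume "0 \<le> s" "s \<le> h"
      then have "(a + s * p, b + h * q) \<in> S"
        using inS[of s h] \<open>0 < h\<close> by simp
      then show "((\<lambda>s. w (a + s * p, b + h * q)) has_real_derivative p * w1 (a + s * p, b + h * q)) (at s)"
        and "((\<lambda>s. p * w1 (a + s * p, b + h * q)) has_real_derivative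
              p * (p * w11 (a + s * p, b + h * q))) (at s)"
        by (auto intro!: DERIV_cmult
            chain[of "\<lambda>s. w (s, b + h * q)"] chain[of "\<lambda>s. w1 (s, b + h * q)"] d1 d11)
    qed (simp_all)
    obtain t2 where t2: "0 < t2" "t2 < h" "w (a, b + h * q) = w (a, b)
        + h * (q * w2 (a, b)) + h\<^sup>2 / 2 * (q * (q * w22 (a, b + t2 * q)))"
    proof (rule taylor_second_order[OF \<open>0 < h\<close>,
          of "\<lambda>s. w (a, b + s * q)" "\<lambda>s. q * w2 (a, b + s * q)"
             "\<lambda>s. q * (q * w22 (a, b + s * q))"])
      fix s assume "0 \<le> s" "s \<le> h"
      then have "(a, b + s * q) \<in> S"
        using inS[of 0 s] \<open>0 < h\<close> by simp
      then show "((\<lambda>s. w (a, b + s * q)) has_real_derivative q * w2 (a, b + s * q)) (at s)"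
        and "((\<lambda>s. q * w2 (a, b + s * q)) has_real_derivative
              q * (q * w22 (a, b + s * q))) (at s)"
        by (auto intro!: DERIV_cmult
            chain[of "\<lambda>s. w (a, s)"] chain[of "\<lambda>s. w2 (a, s)"] d2 d22)
    qed (simp_all)
    \<comment> \<open>The mean value theorem, with \<open>w1 (a, b) = 0\<close>, turns the
      first-order term of the horizontal leg into the mixed second-order term.\<close>
    have "\<exists>t>0. t < h \<and> w1 (a, b + h * q) - w1 (a, b + 0 * q) = (h - 0) * (q * w12 (a, b + t * q))"
    proof (rule MVT2[OF \<open>0 < h\<close>])
      fix s assume "0 \<le> s" "s \<le> h"
      then have "(a, b + s * q) \<in> S"
        using inS[of 0 s] \<open>0 < h\<close> by simp
      then show "((\<lambda>s. w1 (a, b + s * q)) has_real_derivative q * w12 (a, b + s * q)) (at s)"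
        by (auto intro!: chain[of "\<lambda>s. w1 (a, s)"] d12)
    qed
    then obtain t3 where t3: "0 < t3" "t3 < h" "w1 (a, b + h * q) = h * (q * w12 (a, b + t3 * q))"
      using w1_0 by auto
    define A where "A = w11 (a + t1 * p, b + h * q)"
    define B where "B = w12 (a, b + t3 * q)"
    define D where "D = w22 (a, b + t2 * q)"
    have "w (a, b) \<le> w (a + h * p, b + h * q)"
      using min inS[of h h] \<open>0 < h\<close> by simp
    then have "0 \<le> h\<^sup>2 / 2 * (A * p\<^sup>2 + 2 * B * p * q + D * q\<^sup>2)"
      unfolding t1(3) t2(3) t3(3) w2_0 A_def B_def D_def by (simp add: power2_eq_square algebra_simps)
    then have pos: "0 \<le> A * p\<^sup>2 + 2 * B * p * q + D * q\<^sup>2"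
      using \<open>0 < h\<close> by (simp add: zero_le_mult_iff)
    have "\<bar>A - w11 (a, b)\<bar> < e'"
      using e1 near'[of t1 h] t1 by (auto simp: A_def m_def)
    then have A: "A * p\<^sup>2 \<le> w11 (a, b) * p\<^sup>2 + e' * p\<^sup>2"
      unfolding distrib_right[symmetric] by (intro mult_right_mono) auto
    have "\<bar>D - w22 (a, b)\<bar> < e'"
      using e3 near'[of 0 t2] t2 by (auto simp: D_def m_def)
    then have D: "D * q\<^sup>2 \<le> w22 (a, b) * q\<^sup>2 + e' * q\<^sup>2"
      unfolding distrib_right[symmetric] by (intro mult_right_mono) auto
    have "\<bar>B - w12 (a, b)\<bar> < e'"
      using e2 near'[of 0 t3] t3 by (auto simp: B_def m_def)
    then have "\<bar>(B - w12 (a, b)) * (p * q)\<bar> \<le> e' * \<bar>p * q\<bar>"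
      unfolding abs_mult[of "B - w12 (a, b)"] by (intro mult_right_mono) auto
    then have B: "B * (p * q) \<le> w12 (a, b) * (p * q) + e' * \<bar>p * q\<bar>"
      by (simp add: algebra_simps abs_if split: if_splits)
    have "e = e' * ?C"
      using C by (simp add: e'_def)
    then have "e = e' * p\<^sup>2 + 2 * (e' * \<bar>p * q\<bar>) + e' * q\<^sup>2 + e'"
      by (simp add: algebra_simps)
    moreover have "2 * B * p * q = 2 * (B * (p * q))"
      "2 * w12 (a, b) * p * q = 2 * (w12 (a, b) * (p * q))"
      by simp_all
    ultimately show ?thesis
      using pos A B D \<open>0 < e'\<close> by linarith
  qed
  then show ?thesis
    by (rule field_le_epsilon)
qed

text \<open>This is the trace of a product of two positive semidefinite matrices. For
  \<open>m11 > 0\<close>, completing the square splits M into \<open>m11\<close> times the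
  projection-like matrix of the vector \<open>(1, m12 / m11)\<close> and the Schur complement in the
  lower corner; each piece has nonnegative trace against A.\<close>

lemma trace_product_nonneg:
  fixes a11 a12 a22 m11 m12 m22 :: real
  assumes A: "\<And>p q. 0 \<le> a11 * p\<^sup>2 + 2 * a12 * p * q + a22 * q\<^sup>2"
    and M: "\<And>p q. 0 \<le> m11 * p\<^sup>2 + 2 * m12 * p * q + m22 * q\<^sup>2"
  shows "0 \<le> a11 * m11 + 2 * a12 * m12 + a22 * m22"
proof -
  have "0 \<le> a22" "0 \<le> m11" "0 \<le> m22"
    using A[of 0 1] M[of 1 0] M[of 0 1] by simp_all
  show ?thesis
  proof (cases "m11 = 0")
    case True
    have "m12 = 0"
    proof (rule ccontr)
      assume "m12 \<noteq> 0"
      \<comment> \<open>With \<open>m11 = 0\<close> the form is affine in \<open>p\<close> at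
        \<open>q = 1\<close>; the chosen \<open>p\<close> gives it the value -1.\<close>
      then show False
        using M[of "- (m22 + 1) / (2 * m12)" 1] True by simp
    qed
    then show ?thesis
      using True \<open>0 \<le> a22\<close> \<open>0 \<le> m22\<close> by simp
  next
    case False
    then have "0 < m11"
      using \<open>0 \<le> m11\<close> by simp
    \<comment> \<open>The Schur complement is the minimum over \<open>p\<close> of the form at
      \<open>q = 1\<close>, attained at \<open>p = - m12 / m11\<close>.\<close>
    have "0 \<le> m22 - m12\<^sup>2 / m11"
      using M[of "- m12 / m11" 1] \<open>0 < m11\<close> by (simp add: field_simps power2_eq_square)
    moreover have "a11 * m11 + 2 * a12 * m12 + a22 * m22 =
        m11 * (a11 * 1\<^sup>2 + 2 * a12 * 1 * (m12 / m11) + a22 * (m12 / m11)\<^sup>2)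
        + a22 * (m22 - m12\<^sup>2 / m11)"
      using \<open>0 < m11\<close> by (simp add: field_simps power2_eq_square)
    ultimately show ?thesis
      using A[of 1 "m12 / m11"] \<open>0 < m11\<close> \<open>0 \<le> a22\<close> by simp
  qed
qed

section \<open>The comparison principle\<close>

lemma C1_on_has_derivative:
  assumes "C1_on S u" "(s, t) \<in> S"
  shows "((\<lambda>s. u (s, t)) has_real_derivative pd1 u (s, t)) (at s)"
    and "((\<lambda>t. u (s, t)) has_real_derivative pd2 u (s, t)) (at t)"
  using assms unfolding C1_on_def pd1_def pd2_def
  by (auto simp: DERIV_deriv_iff_real_differentiable dest!: bspec)

text \<open>The factor \<open>s\<close> in \<open>X2\<close> is constant for the derivative in the
  second variable, so it can be pulled out of \<open>X2 (X2 u)\<close>, where it appears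
  squared.\<close>

lemma grushin_op_C2_on:
  assumes "C2_on S u" "(s, t) \<in> S"
  shows "grushin_op a11 a12 a22 u (s, t) =
    a11 (s, t) * pd1 (pd1 u) (s, t) + 2 * a12 (s, t) * (s * pd2 (pd1 u) (s, t))
      + a22 (s, t) * (s\<^sup>2 * pd2 (pd2 u) (s, t))"
proof -
  have "((\<lambda>t. s * pd2 u (s, t)) has_real_derivative s * pd2 (pd2 u) (s, t)) (at t)"
    using assms C1_on_has_derivative(2) by (auto simp: C2_on_def intro!: DERIV_cmult)
  then have "pd2 (\<lambda>x. fst x * pd2 u x) (s, t) = s * pd2 (pd2 u) (s, t)"
    unfolding pd2_def[of "\<lambda>x. fst x * pd2 u x"] by (simp add: DERIV_imp_deriv)
  then show ?thesis
    by (simp add: grushin_op_def X1_def X2_def power2_eq_square)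
qed

text \<open>At a minimum of \<open>u - f\<close> over \<open>K\<close> with negative value,
  \<open>alt\<close> leaves only a point of \<open>S\<close> at which the operator is strictly
  positive on \<open>f\<close>. The Hessian of \<open>u - f\<close> is nonnegative there, so the
  operator applied to \<open>u\<close> is at least as large and hence positive, contradicting
  \<open>sup\<close>. The disjunction in \<open>alt\<close> treats the boundary, the part where
  \<open>u\<close> is already known to be large, and the strict subsolution region at once.\<close>

lemma grushin_comparison:
  fixes f f1 f2 f11 f12 f22 :: "real \<times> real \<Rightarrow> real"
  assumes ell: "ellipticity_constants l L a11 a12 a22" and "0 \<le> l"
    and u: "C2_on U u" "continuous_on K u"
    and K: "compact K" "S \<subseteq> K" "S \<subseteq> U" "open S"
    and sup: "\<And>x. x \<in> S \<Longrightarrow> grushin_op a11 a12 a22 u x \<le> 0"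
    and f: "continuous_on K f"
    and d1: "\<And>s t. ((\<lambda>s. f (s, t)) has_real_derivative f1 (s, t)) (at s)"
    and d2: "\<And>s t. ((\<lambda>t. f (s, t)) has_real_derivative f2 (s, t)) (at t)"
    and d11: "\<And>s t. ((\<lambda>s. f1 (s, t)) has_real_derivative f11 (s, t)) (at s)"
    and d12: "\<And>s t. ((\<lambda>t. f1 (s, t)) has_real_derivative f12 (s, t)) (at t)"
    and d22: "\<And>s t. ((\<lambda>t. f2 (s, t)) has_real_derivative f22 (s, t)) (at t)"
    and c: "continuous_on S f11" "continuous_on S f12" "continuous_on S f22"
    and alt: "\<And>s t. (s, t) \<in> K \<Longrightarrow> f (s, t) \<le> u (s, t) \<or>
      ((s, t) \<in> S \<and> 0 < a11 (s, t) * f11 (s, t) + 2 * a12 (s, t) * (s * f12 (s, t))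
        + a22 (s, t) * (s\<^sup>2 * f22 (s, t)))"
    and "x \<in> K"
  shows "f x \<le> u x"
proof -
  have "continuous_on K (\<lambda>x. u x - f x)"
    using u f by (intro continuous_intros)
  then obtain z where "z \<in> K" and z: "\<And>x. x \<in> K \<Longrightarrow> u z - f z \<le> u x - f x"
    using continuous_attains_inf[OF K(1), of "\<lambda>x. u x - f x"] \<open>x \<in> K\<close> by blast
  obtain a b where ab: "z = (a, b)"
    by fastforce
  have "f z \<le> u z"
  proof (rule ccontr)
    assume "\<not> f z \<le> u z"
    with alt[of a b] \<open>z \<in> K\<close> have "(a, b) \<in> S"
      and pos: "0 < a11 (a, b) * f11 (a, b) + 2 * a12 (a, b) * (a * f12 (a, b))
        + a22 (a, b) * (a\<^sup>2 * f22 (a, b))"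
      unfolding ab by auto
    define w11 where "w11 x = pd1 (pd1 u) x - f11 x" for x
    define w12 where "w12 x = pd2 (pd1 u) x - f12 x" for x
    define w22 where "w22 x = pd2 (pd2 u) x - f22 x" for x
    have C1: "C1_on U u" "C1_on U (pd1 u)" "C1_on U (pd2 u)"
      using u(1) by (auto simp: C2_on_def)
    have hess: "0 \<le> w11 (a, b) * p\<^sup>2 + 2 * w12 (a, b) * p * q + w22 (a, b) * q\<^sup>2" for p q
    proof (rule hessian_nonneg_at_min[OF \<open>open S\<close> \<open>(a, b) \<in> S\<close>,
          where w = "\<lambda>x. u x - f x" and ?w1.0 = "\<lambda>x. pd1 u x - f1 x" and ?w2.0 = "\<lambda>x. pd2 u x - f2 x"])
      show "continuous_on S w11" "continuous_on S w12" "continuous_on S w22"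
        unfolding w11_def w12_def w22_def
        using C1 c K continuous_on_subset[OF _ \<open>S \<subseteq> U\<close>]
        by (auto simp: C1_on_def intro!: continuous_intros)
      show "u (a, b) - f (a, b) \<le> u x - f x" if "x \<in> S" for x
        using z that K unfolding ab by blast
    qed (use K C1 in \<open>auto simp: w11_def w12_def w22_def
           intro!: DERIV_diff C1_on_has_derivative[of U] d1 d2 d11 d12 d22\<close>)
    \<comment> \<open>Substituting \<open>a * q\<close> for \<open>q\<close> passes from the
      Euclidean Hessian to the matrix of second derivatives along \<open>X1\<close> and
      \<open>X2\<close>; this also covers points with \<open>a = 0\<close>.\<close>
    have hess': "0 \<le> w11 (a, b) * p\<^sup>2 + 2 * (a * w12 (a, b)) * p * q + (a\<^sup>2 * w22 (a, b)) * q\<^sup>2" for p q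
      using hess[of p "a * q"] by (simp add: algebra_simps power_mult_distrib)
    have A: "0 \<le> a11 (a, b) * p\<^sup>2 + 2 * a12 (a, b) * p * q + a22 (a, b) * q\<^sup>2" for p q
    proof -
      have "0 \<le> l * (p\<^sup>2 + q\<^sup>2)"
        using \<open>0 \<le> l\<close> by simp
      then show ?thesis
        using ell unfolding ellipticity_constants_def by (meson order_trans)
    qed
    have trace: "0 \<le> a11 (a, b) * w11 (a, b) + 2 * a12 (a, b) * (a * w12 (a, b))
        + a22 (a, b) * (a\<^sup>2 * w22 (a, b))"
      by (rule trace_product_nonneg[OF A hess'])
    have "grushin_op a11 a12 a22 u (a, b) \<le> 0"
      using sup \<open>(a, b) \<in> S\<close> by blast
    then have "a11 (a, b) * pd1 (pd1 u) (a, b) + 2 * a12 (a, b) * (a * pd2 (pd1 u) (a, b))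
        + a22 (a, b) * (a\<^sup>2 * pd2 (pd2 u) (a, b)) \<le> 0"
      using grushin_op_C2_on[OF u(1)] \<open>(a, b) \<in> S\<close> K by auto
    then show False
      using pos trace by (simp add: w11_def w12_def w22_def algebra_simps)
  qed
  then show ?thesis
    using z[OF \<open>x \<in> K\<close>] by linarith
qed

section \<open>The barrier\<close>

text \<open>Up to a positive factor, the right side minus the left side is the operator applied to
  the Gaussian, with \<open>\<sigma>\<close> standing for \<open>s / (\<bar>a\<bar> + r)\<close>.
  The left side is at most \<open>26 * L\<close>, while ellipticity bounds the right side below by
  \<open>2 * K * l / 2 ^ 16 = 32 * L\<close>; this fixes the choice of \<open>K\<close>.\<close>

lemma gaussian_barrier_elliptic:
  fixes a11 a12 a22 l L X T \<sigma> :: real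
  assumes ell: "\<And>p q. l * (p\<^sup>2 + q\<^sup>2) \<le> a11 * p\<^sup>2 + 2 * a12 * p * q + a22 * q\<^sup>2
      \<and> a11 * p\<^sup>2 + 2 * a12 * p * q + a22 * q\<^sup>2 \<le> L * (p\<^sup>2 + q\<^sup>2)"
    and "0 < l" "l \<le> L" and \<sigma>: "\<sigma>\<^sup>2 \<le> 25" and XT: "1 / 2 ^ 16 \<le> X\<^sup>2 + (\<sigma> * T)\<^sup>2"
    and K: "K = 2 ^ 20 * L / l"
  shows "a11 + a22 * \<sigma>\<^sup>2 < 2 * K * (a11 * X\<^sup>2 + 2 * a12 * X * (\<sigma> * T) + a22 * (\<sigma> * T)\<^sup>2)"
proof -
  have "0 < K"
    using assms by (simp add: K)
  have "a22 * \<sigma>\<^sup>2 \<le> L * 25"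
    using ell[of 0 1] \<sigma> assms(2,3) by (intro mult_mono) auto
  then have "a11 + a22 * \<sigma>\<^sup>2 \<le> 26 * L"
    using ell[of 1 0] by simp
  also have "\<dots> < 2 * K * (l * (1 / 2 ^ 16))"
    using assms by (simp add: K)
  also have "\<dots> \<le> 2 * K * (l * (X\<^sup>2 + (\<sigma> * T)\<^sup>2))"
    using XT \<open>0 < K\<close> \<open>0 < l\<close> by (intro mult_left_mono) auto
  also have "\<dots> \<le> 2 * K * (a11 * X\<^sup>2 + 2 * a12 * X * (\<sigma> * T) + a22 * (\<sigma> * T)\<^sup>2)"
    using ell[of X "\<sigma> * T"] \<open>0 < K\<close> by (intro mult_left_mono) auto
  finally show ?thesis .
qed

section \<open>Grushin balls compared with boxes and ellipses in the rescaled coordinates\<close>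

lemma grushin_ball_iff:
  "(s, t) \<in> grushin_ball (a, b) \<rho> \<longleftrightarrow> \<bar>s - a\<bar> < \<rho> \<and>
    4 * \<bar>t - b\<bar> < (\<rho> - \<bar>s - a\<bar>)\<^sup>2 + 2 * (\<rho> - \<bar>s - a\<bar>) * sqrt (s\<^sup>2 + a\<^sup>2)"
proof -
  define m where "m = sqrt (s\<^sup>2 + a\<^sup>2)"
  have "0 \<le> m" and m2: "m\<^sup>2 = s\<^sup>2 + a\<^sup>2"
    by (auto simp: m_def)
  define v where "v = \<rho> - \<bar>s - a\<bar>"
  have "(s, t) \<in> grushin_ball (a, b) \<rho> \<longleftrightarrow> sqrt (m\<^sup>2 + 4 * \<bar>t - b\<bar>) < v + m"
    unfolding grushin_ball_def grushin_dist_def m2 by (auto simp: m_def v_def)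
  also have "\<dots> \<longleftrightarrow> 0 < v \<and> sqrt (m\<^sup>2 + 4 * \<bar>t - b\<bar>) < v + m"
  \<comment> \<open>The root is at least \<open>m\<close>, which forces \<open>v\<close> to be
    positive; both sides of the inequality can then be squared.\<close>
  proof -
    have "m \<le> sqrt (m\<^sup>2 + 4 * \<bar>t - b\<bar>)"
      by (rule real_le_rsqrt) simp
    then show ?thesis
      by auto
  qed
  also have "\<dots> \<longleftrightarrow> 0 < v \<and> m\<^sup>2 + 4 * \<bar>t - b\<bar> < (v + m)\<^sup>2"
  proof -
    have "sqrt (m\<^sup>2 + 4 * \<bar>t - b\<bar>) < v + m \<longleftrightarrow> m\<^sup>2 + 4 * \<bar>t - b\<bar> < (v + m)\<^sup>2" if "0 < v"
      using that \<open>0 \<le> m\<close> by (metis add_pos_nonneg less_eq_real_def not_less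
          real_less_lsqrt real_le_rsqrt)
    then show ?thesis
      by blast
  qed
  also have "\<dots> \<longleftrightarrow> 0 < v \<and> 4 * \<bar>t - b\<bar> < v\<^sup>2 + 2 * v * m"
    by (simp add: power2_sum)
  finally show ?thesis
    by (simp add: v_def m_def)
qed

text \<open>Horizontally \<open>r / 4 + r / 8\<close> leaves a margin of \<open>5 / 8 * r\<close> in
  the radius. Since \<open>m\<close> is at least \<open>\<bar>a\<bar>\<close>, the vertical width
  allowed by this margin dominates \<open>4 * \<bar>t - b\<bar>\<close>, which is at most
  \<open>(r * \<bar>a\<bar> + r\<^sup>2) / 8\<close>.\<close>

lemma box_in_grushin_ball:
  fixes a b c r s t :: real
  assumes "0 < r" "\<bar>c - a\<bar> = r / 4"
    and s: "\<bar>(s - c) / r\<bar> \<le> 1 / 8" and t: "\<bar>(t - b) / (r * (\<bar>a\<bar> + r))\<bar> \<le> 1 / 32"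
  shows "(s, t) \<in> grushin_ball (a, b) r"
proof -
  define m where "m = sqrt (s\<^sup>2 + a\<^sup>2)"
  have "\<bar>a\<bar> \<le> m"
    unfolding m_def by (rule real_le_rsqrt) simp
  have "\<bar>s - c\<bar> \<le> r / 8"
    using s \<open>0 < r\<close> by (simp add: field_simps)
  then have v: "5 / 8 * r \<le> r - \<bar>s - a\<bar>"
    using assms(2) by linarith
  have "0 < r * (\<bar>a\<bar> + r)"
    using \<open>0 < r\<close> by simp
  then have "\<bar>t - b\<bar> \<le> 1 / 32 * (r * (\<bar>a\<bar> + r))"
    using t by (simp only: abs_divide abs_of_pos pos_divide_le_eq)
  then have t': "\<bar>t - b\<bar> \<le> (r * \<bar>a\<bar> + r\<^sup>2) / 32"
    by (simp add: power2_eq_square algebra_simps)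
  have "0 < r\<^sup>2" "0 \<le> r * \<bar>a\<bar>" "r * \<bar>a\<bar> \<le> r * m"
    using \<open>0 < r\<close> \<open>\<bar>a\<bar> \<le> m\<close> by auto
  moreover have "(5 / 8 * r)\<^sup>2 = 25 / 64 * r\<^sup>2" "2 * (5 / 8 * r) * m = 5 / 4 * (r * m)"
    by (simp_all add: power2_eq_square)
  ultimately have "4 * \<bar>t - b\<bar> < (5 / 8 * r)\<^sup>2 + 2 * (5 / 8 * r) * m"
    using t' by argo
  also have "\<dots> \<le> (r - \<bar>s - a\<bar>)\<^sup>2 + 2 * (r - \<bar>s - a\<bar>) * m"
    using v \<open>0 < r\<close> \<open>\<bar>a\<bar> \<le> m\<close> by (intro add_mono power_mono mult_right_mono) auto
  finally show ?thesis
    unfolding grushin_ball_iff using v \<open>0 < r\<close> by (simp add: m_def)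
qed

text \<open>The rescaled coordinates are bounded by \<open>2 + 1 / 4\<close> and 3, and
  \<open>81 / 16 + 9\<close> is below 15. That 15 is less than 16, the level at which the barrier
  vanishes, makes the final lower bound positive.\<close>

lemma grushin_ball_double_in_ellipse:
  fixes a b c r s t :: real
  assumes "0 < r" "\<bar>c - a\<bar> = r / 4" and st: "(s, t) \<in> grushin_ball (a, b) (2 * r)"
  shows "((s - c) / r)\<^sup>2 + ((t - b) / (r * (\<bar>a\<bar> + r)))\<^sup>2 \<le> 15"
proof -
  define m where "m = sqrt (s\<^sup>2 + a\<^sup>2)"
  define v where "v = 2 * r - \<bar>s - a\<bar>"
  have v: "0 < v" "v \<le> 2 * r" and t: "4 * \<bar>t - b\<bar> < v\<^sup>2 + 2 * v * m"
    using st unfolding grushin_ball_iff by (auto simp: m_def v_def)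
  have "m \<le> \<bar>s\<bar> + \<bar>a\<bar>"
    unfolding m_def by (rule sqrt_sum_squares_le_sum_abs)
  then have m: "0 \<le> m" "m \<le> 2 * \<bar>a\<bar> + 2 * r"
    using v(1) by (auto simp: m_def v_def)
  have "4 * \<bar>t - b\<bar> \<le> (2 * r)\<^sup>2 + 2 * (2 * r) * (2 * \<bar>a\<bar> + 2 * r)"
    using t v m \<open>0 < r\<close>
    by (intro order_trans[OF less_imp_le[OF t]] add_mono mult_mono power_mono) auto
  then have "\<bar>t - b\<bar> \<le> 3 * r\<^sup>2 + 2 * (r * \<bar>a\<bar>)"
    by (simp add: power2_eq_square algebra_simps)
  moreover have "0 \<le> r * \<bar>a\<bar>"
    using \<open>0 < r\<close> by simp
  ultimately have "\<bar>t - b\<bar> \<le> 3 * (r * (\<bar>a\<bar> + r))"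
    by (simp add: power2_eq_square algebra_simps)
  then have T: "\<bar>(t - b) / (r * (\<bar>a\<bar> + r))\<bar> \<le> 3"
    using \<open>0 < r\<close> by (simp add: divide_le_eq abs_mult)
  have "\<bar>s - c\<bar> \<le> 9 / 4 * r"
    using v(1) assms(2) unfolding v_def by linarith
  then have X: "\<bar>(s - c) / r\<bar> \<le> 9 / 4"
    using \<open>0 < r\<close> by (simp add: divide_le_eq)
  have "((t - b) / (r * (\<bar>a\<bar> + r)))\<^sup>2 \<le> 3\<^sup>2" "((s - c) / r)\<^sup>2 \<le> (9 / 4)\<^sup>2"
    using T X by (simp_all only: power2_le_iff_abs_le)
  moreover have "3\<^sup>2 + (9 / 4)\<^sup>2 \<le> (15::real)"
    by (simp add: power2_eq_square)
  ultimately show ?thesis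
    by linarith
qed

text \<open>This is the source of \<open>\<eta> = 14\<close>: the horizontal distance from
  \<open>a\<close> is at most \<open>17 / 4 * r\<close>, so at least \<open>9 * r\<close> of the
  radius remains, and the allowed vertical width \<open>81 * r\<^sup>2 + 18 * r * m\<close> exceeds
  the required \<open>16 * (r * \<bar>a\<bar> + r\<^sup>2)\<close>.\<close>

lemma ellipse_in_grushin_ball:
  fixes a b c r s t :: real
  assumes "0 < r" "\<bar>c - a\<bar> = r / 4"
    and st: "((s - c) / r)\<^sup>2 + ((t - b) / (r * (\<bar>a\<bar> + r)))\<^sup>2 \<le> 16"
  shows "(s, t) \<in> grushin_ball (a, b) (14 * r)" and "\<bar>(s - c) / r\<bar> \<le> 4"
    and "\<bar>(t - b) / (r * (\<bar>a\<bar> + r))\<bar> \<le> 4"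
proof -
  define m where "m = sqrt (s\<^sup>2 + a\<^sup>2)"
  have "\<bar>a\<bar> \<le> m"
    unfolding m_def by (rule real_le_rsqrt) simp
  have "((s - c) / r)\<^sup>2 \<le> 4\<^sup>2" "((t - b) / (r * (\<bar>a\<bar> + r)))\<^sup>2 \<le> 4\<^sup>2"
    using st zero_le_power2[of "(s - c) / r"] zero_le_power2[of "(t - b) / (r * (\<bar>a\<bar> + r))"]
    by (simp_all only: power2_eq_square[of 4])
  then show X: "\<bar>(s - c) / r\<bar> \<le> 4" and T: "\<bar>(t - b) / (r * (\<bar>a\<bar> + r))\<bar> \<le> 4"
    by (simp_all only: abs_le_square_iff[symmetric] abs_numeral)
  have "\<bar>s - c\<bar> \<le> 4 * r"
    using X \<open>0 < r\<close> by (simp add: divide_le_eq)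
  then have v: "9 * r \<le> 14 * r - \<bar>s - a\<bar>"
    using assms(1,2) by linarith
  have "0 < r * (\<bar>a\<bar> + r)"
    using \<open>0 < r\<close> by simp
  then have "\<bar>t - b\<bar> \<le> 4 * (r * (\<bar>a\<bar> + r))"
    using T by (simp only: abs_divide abs_of_pos pos_divide_le_eq)
  then have t': "\<bar>t - b\<bar> \<le> 4 * (r * \<bar>a\<bar> + r\<^sup>2)"
    by (simp add: power2_eq_square algebra_simps)
  have "0 < r\<^sup>2" "0 \<le> r * \<bar>a\<bar>" "r * \<bar>a\<bar> \<le> r * m"
    using \<open>0 < r\<close> \<open>\<bar>a\<bar> \<le> m\<close> by auto
  moreover have "(9 * r)\<^sup>2 = 81 * r\<^sup>2" "2 * (9 * r) * m = 18 * (r * m)"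
    by (simp_all add: power2_eq_square)
  ultimately have "4 * \<bar>t - b\<bar> < (9 * r)\<^sup>2 + 2 * (9 * r) * m"
    using t' by argo
  also have "\<dots> \<le> (14 * r - \<bar>s - a\<bar>)\<^sup>2 + 2 * (14 * r - \<bar>s - a\<bar>) * m"
    using v \<open>0 < r\<close> \<open>\<bar>a\<bar> \<le> m\<close> by (intro add_mono power_mono mult_right_mono) auto
  finally show "(s, t) \<in> grushin_ball (a, b) (14 * r)"
    unfolding grushin_ball_iff using v \<open>0 < r\<close> by (simp add: m_def)
qed

text \<open>The factor \<open>s / (\<bar>a\<bar> + r)\<close> is what the degenerate coefficient of
  \<open>X2\<close> becomes after rescaling. Off the strip \<open>\<bar>X\<bar> \<le> 1 / 8\<close>
  the first square suffices. On it, the shift of \<open>c\<close> away from the line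
  \<open>s = 0\<close> gives \<open>\<bar>s\<bar> \<ge> \<bar>a\<bar> + r / 8\<close>, so the factor
  is at least 1/8 in absolute value and the second square is at least
  \<open>(1 / 8 * (1 / 32))\<^sup>2 = 1 / 2 ^ 16\<close>.\<close>

lemma barrier_nondegenerate:
  fixes a c r s T :: real
  assumes "0 < r" and c: "c = (if 0 \<le> a then a + r / 4 else a - r / 4)"
    and off: "1 / 8 < \<bar>(s - c) / r\<bar> \<or> 1 / 32 < \<bar>T\<bar>"
  shows "1 / 2 ^ 16 \<le> ((s - c) / r)\<^sup>2 + (s / (\<bar>a\<bar> + r) * T)\<^sup>2"
proof (cases "1 / 8 < \<bar>(s - c) / r\<bar>")
  case True
  then have "(1 / 8)\<^sup>2 \<le> ((s - c) / r)\<^sup>2"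
    by (simp only: abs_le_square_iff[symmetric])
  moreover have "0 \<le> (s / (\<bar>a\<bar> + r) * T)\<^sup>2"
    by simp
  moreover have "1 / 2 ^ 16 \<le> (1 / 8 :: real)\<^sup>2"
    by (simp add: power2_eq_square)
  ultimately show ?thesis
    by linarith
next
  case False
  then have T: "1 / 32 < \<bar>T\<bar>" and "\<bar>s - c\<bar> \<le> r / 8"
    using off \<open>0 < r\<close> by (auto simp: field_simps)
  moreover have "\<bar>a\<bar> + r / 4 \<le> \<bar>c\<bar>"
    using \<open>0 < r\<close> by (cases "0 \<le> a") (simp_all add: c)
  ultimately have "\<bar>a\<bar> + r / 8 \<le> \<bar>s\<bar>"
    by linarith
  then have "1 / 8 \<le> \<bar>s / (\<bar>a\<bar> + r)\<bar>"
    using \<open>0 < r\<close> by (simp add: field_simps)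
  then have "1 / 8 * (1 / 32) \<le> \<bar>s / (\<bar>a\<bar> + r) * T\<bar>"
    unfolding abs_mult using T by (intro mult_mono) auto
  then have "(1 / 8 * (1 / 32))\<^sup>2 \<le> (s / (\<bar>a\<bar> + r) * T)\<^sup>2"
    by (simp only: abs_le_square_iff[symmetric])
  moreover have "0 \<le> ((s - c) / r)\<^sup>2"
    by simp
  moreover have "1 / 2 ^ 16 \<le> (1 / 8 * (1 / 32) :: real)\<^sup>2"
    by (simp add: power2_eq_square)
  ultimately show ?thesis
    by linarith
qed

section \<open>The double ball property with explicit constants\<close>

lemma grushin_double_ball:
  fixes l L r K :: real
  assumes ell: "ellipticity_constants l L a11 a12 a22" and l: "0 < l" "l \<le> L" and "0 < r"
    and K: "K = 2 ^ 20 * L / l"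
  shows "double_ball_property (grushin_op a11 a12 a22) 14 (exp (- 15 * K) - exp (- 16 * K)) y r"
  unfolding double_ball_property_def
proof (intro allI impI ballI, elim conjE)
  fix u x
  assume u: "C2_on (grushin_ball y (14 * r)) u" "continuous_on (closure (grushin_ball y (14 * r))) u"
    and sup: "\<forall>x\<in>grushin_ball y (14 * r). 0 \<le> u x \<and> grushin_op a11 a12 a22 u x \<le> 0"
    and one: "\<forall>x\<in>grushin_ball y r. 1 \<le> u x"
    and x: "x \<in> grushin_ball y (2 * r)"
  obtain a b where y: "y = (a, b)"
    by fastforce
  have "0 < K"
    using l by (simp add: K)
  define c where "c = (if 0 \<le> a then a + r / 4 else a - r / 4)"
  have c: "\<bar>c - a\<bar> = r / 4"
    using \<open>0 < r\<close> by (auto simp: c_def)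
  define k where "k = \<bar>a\<bar> + r"
  have "0 < k"
    using \<open>0 < r\<close> by (simp add: k_def)
  define X :: "real \<times> real \<Rightarrow> real" where "X z = (fst z - c) / r" for z
  define T :: "real \<times> real \<Rightarrow> real" where "T z = (snd z - b) / (r * k)" for z
  define E where "E z = exp (- K * ((X z)\<^sup>2 + (T z)\<^sup>2))" for z
  \<comment> \<open>Subtracting the value of the Gaussian at \<open>Q = 16\<close> makes the barrier
    vanish on the boundary of the ellipse, where only \<open>u \<ge> 0\<close> is known.\<close>
  define f where "f z = E z - exp (- 16 * K)" for z
  define f1 where "f1 z = - 2 * K / r * X z * E z" for z
  define f2 where "f2 z = - 2 * K / (r * k) * T z * E z" for z
  define f11 where "f11 z = 2 * K / r\<^sup>2 * (2 * K * (X z)\<^sup>2 - 1) * E z" for z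
  define f12 where "f12 z = 4 * K\<^sup>2 / (r\<^sup>2 * k) * X z * T z * E z" for z
  define f22 where "f22 z = 2 * K / (r\<^sup>2 * k\<^sup>2) * (2 * K * (T z)\<^sup>2 - 1) * E z" for z
  note defs = X_def T_def E_def f_def f1_def f2_def f11_def f12_def f22_def
  define Q where "Q = (\<lambda>z. (X z)\<^sup>2 + (T z)\<^sup>2)"
  \<comment> \<open>The comparison runs on a closed ellipse inside the open ball of radius
    \<open>14 * r\<close>, so the differential inequality for \<open>u\<close> holds on all of
    it.\<close>
  define C where "C = {z. Q z \<le> 16}"
  define S where "S = {z. Q z < 16}"
  have Q_cont: "continuous_on UNIV Q"
    unfolding Q_def X_def T_def using \<open>0 < r\<close> \<open>0 < k\<close> by (intro continuous_intros) auto
  have "open S"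
    unfolding S_def by (rule open_Collect_less[OF Q_cont]) simp
  have C_bounds: "(s, t) \<in> grushin_ball y (14 * r)" "\<bar>X (s, t)\<bar> \<le> 4" "\<bar>T (s, t)\<bar> \<le> 4"
    if "(s, t) \<in> C" for s t
    using ellipse_in_grushin_ball[OF \<open>0 < r\<close> c, of s t b] that
    by (auto simp: C_def Q_def X_def T_def k_def y)
  then have C_ball: "C \<subseteq> grushin_ball y (14 * r)"
    by auto
  have "compact C"
  proof -
    have "closed C"
      unfolding C_def by (rule closed_Collect_le[OF Q_cont]) simp
    moreover have "C \<subseteq> cbox (c - 4 * r, b - 4 * (r * k)) (c + 4 * r, b + 4 * (r * k))"
    proof (rule subrelI)
      fix s t assume "(s, t) \<in> C"
      then have "\<bar>s - c\<bar> \<le> 4 * r" "\<bar>t - b\<bar> \<le> 4 * (r * k)"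
        using C_bounds(2,3)[of s t] \<open>0 < r\<close> \<open>0 < k\<close>
        by (auto simp: X_def T_def divide_le_eq abs_mult)
      then show "(s, t) \<in> cbox (c - 4 * r, b - 4 * (r * k)) (c + 4 * r, b + 4 * (r * k))"
        by (auto simp: cbox_Pair_eq)
    qed
    ultimately show ?thesis
      by (meson bounded_cbox bounded_subset compact_eq_bounded_closed)
  qed
  have "S \<subseteq> C"
    by (auto simp: S_def C_def)
  have ineq: "f (s, t) \<le> u (s, t) \<or>
      ((s, t) \<in> S \<and> 0 < a11 (s, t) * f11 (s, t) + 2 * a12 (s, t) * (s * f12 (s, t))
        + a22 (s, t) * (s\<^sup>2 * f22 (s, t)))" if "(s, t) \<in> C" for s t
  proof -
    have Q16: "Q (s, t) \<le> 16"
      using that by (simp add: C_def)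
    \<comment> \<open>On the boundary \<open>f = 0\<close>; on the small box
      \<open>f \<le> 1\<close> and \<open>u \<ge> 1\<close>; elsewhere \<open>f\<close> is a strict
      subsolution.\<close>
    consider "Q (s, t) = 16" | "\<bar>X (s, t)\<bar> \<le> 1 / 8" "\<bar>T (s, t)\<bar> \<le> 1 / 32"
      | "Q (s, t) < 16" "1 / 8 < \<bar>X (s, t)\<bar> \<or> 1 / 32 < \<bar>T (s, t)\<bar>"
      using Q16 by (metis less_eq_real_def not_less)
    then show ?thesis
    proof cases
      case 1
      then have "f (s, t) = 0"
        by (simp add: f_def E_def Q_def)
      then show ?thesis
        using sup C_ball that by auto
    next
      case 2
      then have "(s, t) \<in> grushin_ball y r"
        using box_in_grushin_ball[OF \<open>0 < r\<close> c, of s t b] by (simp add: X_def T_def k_def y)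
      moreover have "E (s, t) \<le> 1"
        using \<open>0 < K\<close> by (simp add: E_def)
      then have "f (s, t) \<le> 1"
        unfolding f_def by (smt (verit) exp_ge_zero)
      ultimately show ?thesis
        using one by force
    next
      case 3
      define \<sigma> where "\<sigma> = s / k"
      \<comment> \<open>From \<open>4 * r + r / 4 + \<bar>a\<bar>\<close>; this yields the bound 25
        on \<open>\<sigma>\<^sup>2\<close>.\<close>
      have "\<bar>s\<bar> \<le> 5 * k"
      proof -
        have "\<bar>s - c\<bar> \<le> 4 * r"
          using C_bounds(2)[OF that] \<open>0 < r\<close> by (simp add: X_def divide_le_eq)
        moreover have "\<bar>s\<bar> \<le> \<bar>s - c\<bar> + \<bar>c - a\<bar> + \<bar>a\<bar>" "0 \<le> \<bar>a\<bar>"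
          by arith+
        ultimately show ?thesis
          using c \<open>0 < r\<close> unfolding k_def by argo
      qed
      then have "\<bar>\<sigma>\<bar> \<le> \<bar>5\<bar>"
        using \<open>0 < k\<close> by (simp add: \<sigma>_def divide_le_eq)
      then have "\<sigma>\<^sup>2 \<le> 25"
        unfolding abs_le_square_iff by simp
      have "1 / 2 ^ 16 \<le> (X (s, t))\<^sup>2 + (\<sigma> * T (s, t))\<^sup>2"
        using barrier_nondegenerate[OF \<open>0 < r\<close> c_def, of s "T (s, t)"] 3(2)
        by (simp add: X_def \<sigma>_def k_def)
      then have core: "a11 (s, t) + a22 (s, t) * \<sigma>\<^sup>2 < 2 * K * (a11 (s, t) * (X (s, t))\<^sup>2
          + 2 * a12 (s, t) * X (s, t) * (\<sigma> * T (s, t)) + a22 (s, t) * (\<sigma> * T (s, t))\<^sup>2)"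
        using ell l \<open>\<sigma>\<^sup>2 \<le> 25\<close> K
        by (intro gaussian_barrier_elliptic) (auto simp: ellipticity_constants_def)
      \<comment> \<open>Each factor \<open>s\<close> pairs with a factor \<open>1 / k\<close> from
        differentiating \<open>T\<close>, so the degeneracy enters only through
        \<open>\<sigma>\<close>, and the sign is that of the bracket controlled by
        \<open>core\<close>.\<close>
      have "a11 (s, t) * f11 (s, t) + 2 * a12 (s, t) * (s * f12 (s, t)) + a22 (s, t) * (s\<^sup>2 * f22 (s, t))
        = 2 * K / r\<^sup>2 * E (s, t) * (2 * K * (a11 (s, t) * (X (s, t))\<^sup>2
          + 2 * a12 (s, t) * X (s, t) * (\<sigma> * T (s, t)) + a22 (s, t) * (\<sigma> * T (s, t))\<^sup>2)
          - (a11 (s, t) + a22 (s, t) * \<sigma>\<^sup>2))"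
      proof -
        have s12: "s * f12 (s, t) = 4 * K\<^sup>2 / r\<^sup>2 * \<sigma> * X (s, t) * T (s, t) * E (s, t)"
          using \<open>0 < k\<close> by (simp add: f12_def \<sigma>_def)
        have s22: "s\<^sup>2 * f22 (s, t) = 2 * K / r\<^sup>2 * \<sigma>\<^sup>2 * (2 * K * (T (s, t))\<^sup>2 - 1) * E (s, t)"
          using \<open>0 < k\<close> by (simp add: f22_def \<sigma>_def power_divide)
        show ?thesis
          unfolding s12 s22 f11_def using \<open>0 < r\<close> by (simp add: field_simps power2_eq_square)
      qed
      moreover have "0 < 2 * K / r\<^sup>2 * E (s, t)"
        using \<open>0 < K\<close> \<open>0 < r\<close> by (simp add: E_def)
      ultimately have "0 < a11 (s, t) * f11 (s, t) + 2 * a12 (s, t) * (s * f12 (s, t))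
          + a22 (s, t) * (s\<^sup>2 * f22 (s, t))"
        using core by (simp only: mult_pos_pos diff_gt_0_iff_gt)
      then show ?thesis
        using 3(1) by (simp add: S_def)
    qed
  qed
  have Qx: "Q x \<le> 15"
    using grushin_ball_double_in_ellipse[OF \<open>0 < r\<close> c, of "fst x" "snd x" b] x
    by (simp add: Q_def X_def T_def k_def y)
  have "f x \<le> u x"
  proof (rule grushin_comparison[OF ell _ u(1) _ \<open>compact C\<close> \<open>S \<subseteq> C\<close> _ \<open>open S\<close>, where f = f
        and ?f1.0 = f1 and ?f2.0 = f2 and ?f11.0 = f11 and ?f12.0 = f12 and ?f22.0 = f22])
    show "continuous_on C u"
      using u(2) C_ball closure_subset continuous_on_subset by blast
    show "continuous_on C f" "continuous_on S f11" "continuous_on S f12" "continuous_on S f22"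
      unfolding defs using \<open>0 < r\<close> \<open>0 < k\<close> by (auto intro!: continuous_intros)
    fix s t
    have X1: "((\<lambda>s. X (s, t)) has_real_derivative 1 / r) (at s)"
      and X2: "((\<lambda>t. X (s, t)) has_real_derivative 0) (at t)"
      and T1: "((\<lambda>s. T (s, t)) has_real_derivative 0) (at s)"
      and T2: "((\<lambda>t. T (s, t)) has_real_derivative 1 / (r * k)) (at t)"
      unfolding X_def T_def using \<open>0 < r\<close> \<open>0 < k\<close> by (auto intro!: derivative_eq_intros)
    have E1: "((\<lambda>s. E (s, t)) has_real_derivative - 2 * K / r * X (s, t) * E (s, t)) (at s)"
      and E2: "((\<lambda>t. E (s, t)) has_real_derivative - 2 * K / (r * k) * T (s, t) * E (s, t)) (at t)"
      unfolding E_def by (auto intro!: derivative_eq_intros X1 X2 T1 T2)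
    show "((\<lambda>s. f (s, t)) has_real_derivative f1 (s, t)) (at s)"
      "((\<lambda>t. f (s, t)) has_real_derivative f2 (s, t)) (at t)"
      unfolding f_def f1_def f2_def by (auto intro!: derivative_eq_intros E1 E2)
    show "((\<lambda>s. f1 (s, t)) has_real_derivative f11 (s, t)) (at s)"
      "((\<lambda>t. f1 (s, t)) has_real_derivative f12 (s, t)) (at t)"
      "((\<lambda>t. f2 (s, t)) has_real_derivative f22 (s, t)) (at t)"
      unfolding f1_def f2_def f11_def f12_def f22_def using \<open>0 < r\<close> \<open>0 < k\<close>
      by (auto intro!: derivative_eq_intros X1 X2 T2 E1 E2 simp: field_simps power2_eq_square)
  qed (use sup C_ball \<open>S \<subseteq> C\<close> l ineq Qx in \<open>auto simp: C_def\<close>)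
  moreover have "exp (- 15 * K) \<le> E x"
    using Qx \<open>0 < K\<close> by (simp add: E_def Q_def)
  ultimately show "exp (- 15 * K) - exp (- 16 * K) \<le> u x"
    by (simp add: f_def)
qed

theorem corollary6p7:
  fixes lam Lam :: real
  assumes "0 < lam" and "lam \<le> Lam"
  shows "\<exists>\<eta> > 2. \<exists>\<gamma> > 0.
    \<forall>a11 a12 a22 :: real \<times> real \<Rightarrow> real.
      a11 \<in> borel_measurable lebesgue \<longrightarrow>
      a12 \<in> borel_measurable lebesgue \<longrightarrow>
      a22 \<in> borel_measurable lebesgue \<longrightarrow>
      ellipticity_constants lam Lam a11 a12 a22 \<longrightarrow>
      (\<forall>y. \<forall>r > 0. double_ball_property (grushin_op a11 a12 a22) \<eta> \<gamma> y r)"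
proof (intro exI conjI allI impI)
  show "(2::real) < 14"
    by simp
  \<comment> \<open>Positivity of this exponent separates the two exponentials. It involves only the
    ratio of the ellipticity constants, so \<open>\<gamma>\<close> is uniform in the operator,
    \<open>y\<close> and \<open>r\<close>.\<close>
  have "0 < 2 ^ 20 * Lam / lam"
    using assms by simp
  then show "0 < exp (- 15 * (2 ^ 20 * Lam / lam)) - exp (- 16 * (2 ^ 20 * Lam / lam))"
    by simp
qed (use grushin_double_ball assms in blast)

end
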